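(* Let $T\in \mathcal{B}_A(\mathcal{H})$. Then $$d\omega_A(T) \leq \sqrt{\omega_A^2\left(T^\sharp T - T\right) + 2\,\|T\|_A^2\,\omega_A(T)}.$$
   Context: $\mathcal{H}$ is a complex Hilbert space with inner product $\langle\cdot\mid\cdot\rangle$, $\mathcal{B}(\mathcal{H})$ is the algebra of bounded linear operators on $\mathcal{H}$, and $A\in\mathcal{B}(\mathcal{H})$ is a fixed nonzero positive (semidefinite) operator. Put $\langle x\mid y\rangle_A=\langle Ax\mid y\rangle$ and $\|x\|_A=\langle x\mid x\rangle_A^{1/2}$. $\mathcal{B}_A(\mathcal{H})=\{T\in\mathcal{B}(\mathcal{H}) : \mathcal{R}(T^*A)\subseteq\mathcal{R}(A)\}$, where $\mathcal{R}$ denotes range; for $T\in\mathcal{B}_A(\mathcal{H})$, $T^\sharp$ denotes the unique $X\in\mathcal{B}(\mathcal{H})$ with $AX=T^*A$ and $\mathcal{R}(X)\subseteq\overline{\mathcal{R}(A)}$ (so $\langle Tx\mid y\rangle_A=\langle x\mid T^\sharp y\rangle_A$). For $T\in\mathcal{B}_A(\mathcal{H})$: $\|T\|_A=\sup\{\|Tx\|_A : \|x\|_A=1\}$, $\omega_A(T)=\sup\{|\langle Tx\mid x\rangle_A| : \|x\|_A=1\}$, and the $A$-Davis-Wielandt radius is $d\omega_A(T)=\sup\{\sqrt{|\langle Tx\mid x\rangle_A|^2+\|Tx\|_A^4} : \|x\|_A=1\}$. All of these are finite. *)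

theory Defs
  imports "HOL-Analysis.Analysis"
begin

text \<open>
  Complex inner product spaces, as an extension of the library class of real inner product
  spaces. The complex inner product is linear in the first argument and conjugate-linear in the
  second one. Every complex inner product space is a real one under the real part of
  its inner product, with the same norm; the last axiom says that the inherited norm (and hence
  completeness, boundedness and closures) is the one of the complex inner product.
\<close>

class complex_inner = real_inner +
  fixes scaleC :: "complex \<Rightarrow> 'a \<Rightarrow> 'a"  (infixr "*\<^sub>C" 75)
    and cinner :: "'a \<Rightarrow> 'a \<Rightarrow> complex"
  assumes scaleC_add_right: "a *\<^sub>C (x + y) = a *\<^sub>C x + a *\<^sub>C y"
    and scaleC_add_left: "(a + b) *\<^sub>C x = a *\<^sub>C x + b *\<^sub>C x"
    and scaleC_scaleC: "a *\<^sub>C b *\<^sub>C x = (a * b) *\<^sub>C x"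
    and scaleC_of_real: "complex_of_real r *\<^sub>C x = r *\<^sub>R x"
    and cinner_add_left: "cinner (x + y) z = cinner x z + cinner y z"
    and cinner_scaleC_left: "cinner (a *\<^sub>C x) y = a * cinner x y"
    and cinner_commute: "cinner y x = cnj (cinner x y)"
    and Re_cinner: "Re (cinner x y) = inner x y"

class complex_hilbert = complex_inner + complete_space

instantiation complex :: complex_hilbert
begin

definition scaleC_complex :: "complex \<Rightarrow> complex \<Rightarrow> complex"
  where "scaleC_complex a x = a * x"

definition cinner_complex :: "complex \<Rightarrow> complex \<Rightarrow> complex"
  where "cinner_complex x y = x * cnj y"

instance
  by standard
    (auto simp: scaleC_complex_def cinner_complex_def inner_complex_def algebra_simps
      scaleR_conv_of_real)

end

definition bounded_clinear :: "('a::complex_hilbert \<Rightarrow> 'a) \<Rightarrow> bool"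
  where "bounded_clinear T \<longleftrightarrow> bounded_linear T \<and> (\<forall>c x. T (c *\<^sub>C x) = c *\<^sub>C T x)"

text \<open>The description is unique because the inner product is definite; existence for bounded
  operators is the Riesz representation theorem.\<close>

definition cadjoint :: "('a::complex_hilbert \<Rightarrow> 'a) \<Rightarrow> 'a \<Rightarrow> 'a"
  where "cadjoint T = (THE S. bounded_clinear S \<and> (\<forall>x y. cinner (T x) y = cinner x (S y)))"

definition positive_op :: "('a::complex_hilbert \<Rightarrow> 'a) \<Rightarrow> bool"
  where "positive_op A \<longleftrightarrow>
    bounded_clinear A \<and> (\<forall>x. cinner (A x) x \<in> \<real> \<and> 0 \<le> Re (cinner (A x) x))"

definition A_inner :: "('a::complex_hilbert \<Rightarrow> 'a) \<Rightarrow> 'a \<Rightarrow> 'a \<Rightarrow> complex"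
  where "A_inner A x y = cinner (A x) y"

definition A_norm :: "('a::complex_hilbert \<Rightarrow> 'a) \<Rightarrow> 'a \<Rightarrow> real"
  where "A_norm A x = sqrt (Re (A_inner A x x))"

definition B_A :: "('a::complex_hilbert \<Rightarrow> 'a) \<Rightarrow> ('a \<Rightarrow> 'a) set"
  where "B_A A = {T. bounded_clinear T \<and> range (cadjoint T \<circ> A) \<subseteq> range A}"

text \<open>Existence for \<open>T \<in> B_A A\<close> is Douglas' range inclusion theorem.\<close>

definition A_sharp :: "('a::complex_hilbert \<Rightarrow> 'a) \<Rightarrow> ('a \<Rightarrow> 'a) \<Rightarrow> 'a \<Rightarrow> 'a"
  where "A_sharp A T =
    (THE X. bounded_clinear X \<and> A \<circ> X = cadjoint T \<circ> A \<and> range X \<subseteq> closure (range A))"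

text \<open>The following suprema are taken in the reals. For a nonzero positive \<open>A\<close> the set of
  \<open>A\<close>-unit vectors is nonempty, and for \<open>T \<in> B_A A\<close> the sets of values are bounded.\<close>

definition A_op_norm :: "('a::complex_hilbert \<Rightarrow> 'a) \<Rightarrow> ('a \<Rightarrow> 'a) \<Rightarrow> real"
  where "A_op_norm A T = (SUP x\<in>{x. A_norm A x = 1}. A_norm A (T x))"

definition A_num_radius :: "('a::complex_hilbert \<Rightarrow> 'a) \<Rightarrow> ('a \<Rightarrow> 'a) \<Rightarrow> real"
  where "A_num_radius A T = (SUP x\<in>{x. A_norm A x = 1}. cmod (A_inner A (T x) x))"

definition A_DW_radius :: "('a::complex_hilbert \<Rightarrow> 'a) \<Rightarrow> ('a \<Rightarrow> 'a) \<Rightarrow> real"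
  where "A_DW_radius A T =
    (SUP x\<in>{x. A_norm A x = 1}. sqrt ((cmod (A_inner A (T x) x))\<^sup>2 + (A_norm A (T x)) ^ 4))"

end

theory Submission imports Defs
begin

text \<open>
  For an \<open>A\<close>-unit vector \<open>x\<close> put \<open>a = \<langle>Tx | x\<rangle>\<^sub>A\<close> and
  \<open>n = \<parallel>Tx\<parallel>\<^sub>A\<^sup>2 = \<langle>T\<^sup>\<sharp>Tx | x\<rangle>\<^sub>A\<close>. Then
  \<open>|a|\<^sup>2 + n\<^sup>2 = |n - a|\<^sup>2 + 2 n Re a\<close>, and the two summands are estimated by the suprema.
  The remaining work is that \<open>T\<^sup>\<sharp>\<close> exists and that the suprema are finite. Minimizing a
  quadratic functional gives adjoints and orthogonal projections; projecting the solutions of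
  \<open>Aw = T\<^sup>*Ax\<close> to the closure of the range of \<open>A\<close> gives \<open>T\<^sup>\<sharp>\<close>, which is bounded by the
  uniform boundedness principle. Finally \<open>S = T\<^sup>\<sharp>T\<close> is symmetric and positive for the
  semi-inner product, so \<open>\<parallel>S\<^sup>nx\<parallel>\<^sub>A\<close> is log-convex in \<open>n\<close>, which forces
  \<open>\<parallel>Sx\<parallel>\<^sub>A \<le> \<parallel>S\<parallel> \<parallel>x\<parallel>\<^sub>A\<close>.
\<close>

section \<open>Minimization and uniform boundedness in real inner product spaces\<close>

lemma subspace_closure:
  fixes S :: "'a::real_normed_vector set"
  assumes "subspace S"
  shows "subspace (closure S)"
  unfolding subspace_def
proof (intro conjI ballI allI)
  show "0 \<in> closure S"
    using assms closure_subset subspace_0 by blast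
next
  fix x y assume "x \<in> closure S" "y \<in> closure S"
  then obtain f g where "\<forall>n. f n \<in> S" "f \<longlonglongrightarrow> x" "\<forall>n. g n \<in> S" "g \<longlonglongrightarrow> y"
    unfolding closure_sequential by blast
  then have "\<forall>n. f n + g n \<in> S" "(\<lambda>n. f n + g n) \<longlonglongrightarrow> x + y"
    using assms by (auto intro: subspace_add tendsto_add)
  then show "x + y \<in> closure S"
    unfolding closure_sequential by (intro exI[of _ "\<lambda>n. f n + g n"]) auto
next
  fix c x assume "x \<in> closure S"
  then obtain f where "\<forall>n. f n \<in> S" "f \<longlonglongrightarrow> x"
    unfolding closure_sequential by blast
  then have "\<forall>n. c *\<^sub>R f n \<in> S" "(\<lambda>n. c *\<^sub>R f n) \<longlonglongrightarrow> c *\<^sub>R x"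
    using assms by (auto intro: subspace_scale tendsto_intros)
  then show "c *\<^sub>R x \<in> closure S"
    unfolding closure_sequential by (intro exI[of _ "\<lambda>n. c *\<^sub>R f n"]) auto
qed

text \<open>A parabola through the origin that never drops below zero has slope zero there. This is
  the first-order condition at a minimizer.\<close>

lemma linear_coeff_zero:
  fixes b c :: real
  assumes "\<And>t. 0 \<le> 2 * t * b + t\<^sup>2 * c"
  shows "b = 0"
proof (rule ccontr)
  assume "b \<noteq> 0"
  \<comment> \<open>Replacing \<open>c\<close> by the positive upper bound \<open>d\<close> puts the
    minimum of the parabola at \<open>- b / d\<close>, without a case distinction on the sign of
    \<open>c\<close>.\<close>
  define d where "d = \<bar>c\<bar> + 1"
  have d: "d > 0" "c \<le> d" by (auto simp: d_def)
  have "0 \<le> 2 * (- b / d) * b + (- b / d)\<^sup>2 * c" by (rule assms)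
  also have "\<dots> \<le> 2 * (- b / d) * b + (- b / d)\<^sup>2 * d"
    using d by (intro add_left_mono mult_left_mono) auto
  also have "\<dots> = - b\<^sup>2 / d"
    using d by (simp add: power2_eq_square field_simps)
  finally show False
    using d \<open>b \<noteq> 0\<close> by (simp add: divide_simps)
qed

text \<open>If \<open>f\<close> is represented by \<open>y\<close> on \<open>M\<close>, then
  \<open>(norm m)\<^sup>2 - 2 * f m\<close> is, up to a constant, the squared distance from
  \<open>m\<close> to \<open>y\<close>; so \<open>y\<close> is sought as its minimizer. Taking
  \<open>M = UNIV\<close> gives adjoints, taking \<open>f\<close> to be the inner product with a
  fixed vector gives the orthogonal projection to \<open>M\<close>.\<close>

lemma riesz_subspace:
  fixes f :: "'a::{real_inner, complete_space} \<Rightarrow> real"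
  assumes f: "bounded_linear f" and M: "subspace M" "closed M"
  obtains y where "y \<in> M" "\<And>m. m \<in> M \<Longrightarrow> f m = inner y m"
proof -
  interpret f: bounded_linear f by fact
  define \<phi> where "\<phi> m = (norm m)\<^sup>2 - 2 * f m" for m
  obtain K where K: "\<And>x. \<bar>f x\<bar> \<le> norm x * K"
    using f.bounded by auto
  have lower: "- K\<^sup>2 \<le> \<phi> m" for m
  proof -
    have "0 \<le> (norm m - K)\<^sup>2" by simp
    then show ?thesis
      using K[of m] by (simp add: \<phi>_def power2_diff)
  qed
  define d where "d = Inf (\<phi> ` M)"
  have bdd: "bdd_below (\<phi> ` M)"
    using lower by (intro bdd_belowI2[where m="- K\<^sup>2"]) auto
  have d_le: "d \<le> \<phi> m" if "m \<in> M" for m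
    unfolding d_def using bdd that by (intro cInf_lower) auto
  have ne: "\<phi> ` M \<noteq> {}"
    using subspace_0[OF M(1)] by auto
  have "\<exists>m\<in>M. \<phi> m < d + 1 / real (Suc n)" for n
    using cInf_lessD[OF ne, of "d + 1 / real (Suc n)"] by (auto simp: d_def)
  then obtain s where sM: "\<And>n. s n \<in> M" and s: "\<And>n. \<phi> (s n) < d + 1 / real (Suc n)"
    by metis
  \<comment> \<open>The linear terms cancel in the parallelogram identity, and the midpoint has
    value at least \<open>d\<close>. Hence minimizing sequences are Cauchy.\<close>
  have parallelogram: "(norm (x - y))\<^sup>2 \<le> 2 * (\<phi> x + \<phi> y - 2 * d)" if "x \<in> M" "y \<in> M" for x y
  proof -
    define z where "z = (1/2) *\<^sub>R (x + y)"
    have "z \<in> M"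
      unfolding z_def using that M by (intro subspace_scale subspace_add)
    then have "d \<le> \<phi> z" by (rule d_le)
    moreover have "(norm (x - y))\<^sup>2 = 2 * \<phi> x + 2 * \<phi> y - 4 * \<phi> z"
      by (simp only: z_def \<phi>_def power2_norm_eq_inner f.scaleR f.add inner_diff inner_add
          inner_scaleR_left inner_scaleR_right)
        (simp add: inner_commute algebra_simps)
    ultimately show ?thesis by simp
  qed
  have "Cauchy s"
  proof (rule CauchyI)
    fix e :: real assume "0 < e"
    \<comment> \<open>The parallelogram bound for two indices from \<open>N\<close> on is below
      \<open>4 / real (Suc N)\<close>.\<close>
    then obtain N where N: "1 / real (Suc N) < e\<^sup>2 / 4"
      using nat_approx_posE[of "e\<^sup>2 / 4"] by auto
    have "norm (s m - s n) < e" if "N \<le> m" "N \<le> n" for m n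
    proof -
      have "1 / real (Suc m) \<le> 1 / real (Suc N)" "1 / real (Suc n) \<le> 1 / real (Suc N)"
        using that by (auto simp: divide_simps)
      then have "(norm (s m - s n))\<^sup>2 < e\<^sup>2"
        using parallelogram[OF sM sM, of m n] s[of m] s[of n] N by argo
      then show ?thesis
        using \<open>0 < e\<close> power_less_imp_less_base by fastforce
    qed
    then show "\<exists>M. \<forall>m\<ge>M. \<forall>n\<ge>M. norm (s m - s n) < e" by blast
  qed
  then obtain y where y: "s \<longlonglongrightarrow> y"
    using Cauchy_convergent convergent_def by blast
  then have yM: "y \<in> M"
    using M(2) sM closed_sequentially by blast
  have "(\<lambda>n. \<phi> (s n)) \<longlonglongrightarrow> \<phi> y"
    unfolding \<phi>_def using y by (intro tendsto_intros f.tendsto)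
  moreover have "(\<lambda>n. d + 1 / real (Suc n)) \<longlonglongrightarrow> d + 0"
    by (intro tendsto_intros LIMSEQ_Suc[OF lim_1_over_n])
  ultimately have "\<phi> y \<le> d + 0"
    by (rule LIMSEQ_le) (use s in \<open>auto intro: less_imp_le\<close>)
  then have min: "\<phi> y \<le> \<phi> m" if "m \<in> M" for m
    using d_le[OF that] by simp
  have "f m = inner y m" if "m \<in> M" for m
  proof -
    \<comment> \<open>The right-hand side is the change of \<open>\<phi>\<close> from the minimizer
      \<open>y\<close> to \<open>y + t *\<^sub>R m\<close>.\<close>
    have "0 \<le> 2 * t * (inner y m - f m) + t\<^sup>2 * (norm m)\<^sup>2" for t
    proof -
      have "\<phi> y \<le> \<phi> (y + t *\<^sub>R m)"
        using that yM M by (intro min subspace_scale subspace_add)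
      also have "\<phi> (y + t *\<^sub>R m) = \<phi> y + 2 * t * (inner y m - f m) + t\<^sup>2 * (norm m)\<^sup>2"
        by (simp only: \<phi>_def power2_norm_eq_inner f.scaleR f.add inner_add inner_commute
            inner_scaleR_left inner_scaleR_right)
          (simp add: inner_commute power2_eq_square algebra_simps)
      finally show ?thesis by simp
    qed
    then show ?thesis
      using linear_coeff_zero by fastforce
  qed
  with yM show thesis by (rule that)
qed

text \<open>The closed sets \<open>E n\<close> cover the space, so by Baire one of them contains a
  ball. Subtracting the centre turns the bound on this ball into one on all directions.\<close>

lemma uniform_boundedness_inner:
  fixes V :: "'a::{real_inner, complete_space} set"
  assumes pointwise: "\<And>x. \<exists>c. \<forall>v\<in>V. \<bar>inner x v\<bar> \<le> c"
  obtains C where "0 \<le> C" "\<And>v. v \<in> V \<Longrightarrow> norm v \<le> C"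
proof -
  define E where "E n = {x. \<forall>v\<in>V. \<bar>inner x v\<bar> \<le> real n}" for n
  have closed: "closed (E n)" for n
  proof -
    have "E n = (\<Inter>v\<in>V. {x. \<bar>inner x v\<bar> \<le> real n})"
      by (auto simp: E_def)
    also have "closed \<dots>"
      by (intro closed_INT ballI closed_Collect_le continuous_intros)
    finally show ?thesis .
  qed
  have "x \<in> \<Union>(range E)" for x
  proof -
    obtain c where "\<forall>v\<in>V. \<bar>inner x v\<bar> \<le> c"
      using pointwise by blast
    moreover obtain n where "c \<le> real n"
      using real_arch_simple by blast
    ultimately have "x \<in> E n"
      by (force simp: E_def)
    then show ?thesis by blast
  qed
  then have "\<Union>(range E) = UNIV" by blast
  moreover have "interior (\<Union>(range E)) = {}" if "\<And>n. interior (E n) = {}"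
    using Baire_category_alt[of "euclidean :: 'a topology" "range E"] closed that
      completely_metrizable_space_euclidean[where 'a='a]
    by auto
  ultimately have "\<exists>n. interior (E n) \<noteq> {}"
    by (metis UNIV_not_empty interior_UNIV)
  then obtain n x e where e: "0 < e" "cball x e \<subseteq> E n"
    by (metis all_not_in_conv mem_interior_cball)
  have "norm v \<le> 2 * real n / e" if "v \<in> V" for v
  proof (cases "v = 0")
    case False
    \<comment> \<open>The displacement along \<open>v\<close> that just stays in the closed ball;
      pairing it with \<open>v\<close> gives \<open>e * norm v\<close>.\<close>
    define u where "u = (e / norm v) *\<^sub>R v"
    have "norm u = e"
      using False e by (simp add: u_def)
    then have "x + u \<in> E n" "x \<in> E n"
      using e by (auto simp: subset_iff dist_norm)
    then have "\<bar>inner (x + u) v\<bar> \<le> real n" "\<bar>inner x v\<bar> \<le> real n"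
      using that by (auto simp: E_def)
    then have "inner u v \<le> 2 * real n"
      by (simp add: inner_add_left)
    moreover have "inner u v = e * norm v"
      using False by (simp add: u_def dot_square_norm power2_eq_square)
    ultimately show ?thesis
      using e by (simp add: field_simps)
  qed (use e in simp)
  with e show thesis
    by (intro that[of "2 * real n / e"]) auto
qed

section \<open>Complex structure and adjoints\<close>

lemma bounded_clinear_scaleC: "bounded_clinear T \<Longrightarrow> T (c *\<^sub>C x) = c *\<^sub>C T x"
  and bounded_clinear_imp_linear: "bounded_clinear T \<Longrightarrow> bounded_linear T"
  by (auto simp: bounded_clinear_def)

text \<open>The imaginary part of \<open>z\<close> is minus the real part of
  \<open>\<i> * z\<close>. Complex identities thereby reduce to real ones.\<close>

lemma cinner_eq_Complex:
  "cinner x y = Complex (inner x y) (- inner (\<i> *\<^sub>C x) y)"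
  by (simp add: complex_eq_iff Re_cinner[symmetric] cinner_scaleC_left)

lemma cinner_scaleC_right: "cinner x (a *\<^sub>C y) = cnj a * cinner x y"
  by (metis cinner_commute cinner_scaleC_left complex_cnj_mult)

lemma cinner_add_right: "cinner x (y + z) = cinner x y + cinner x z"
  by (metis cinner_add_left cinner_commute complex_cnj_add)

lemma inner_i_right: "inner x (\<i> *\<^sub>C y) = - inner (\<i> *\<^sub>C x) y"
  by (simp add: Re_cinner[symmetric] cinner_scaleC_left cinner_scaleC_right)

lemma complex_linear_if_i_linear:
  fixes S :: "'a::complex_inner \<Rightarrow> 'a"
  assumes "linear S" "\<And>x. S (\<i> *\<^sub>C x) = \<i> *\<^sub>C S x"
  shows "S (c *\<^sub>C x) = c *\<^sub>C S x"
proof -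
  have decomp: "c *\<^sub>C y = Re c *\<^sub>R y + Im c *\<^sub>R (\<i> *\<^sub>C y)" for y :: 'a
    by (subst complex_eq, subst scaleC_add_left)
      (simp add: scaleC_of_real[symmetric] scaleC_scaleC mult.commute)
  show ?thesis
    by (simp add: decomp[of x] decomp[of "S x"] linear_add[OF assms(1)] linear_scale[OF assms(1)]
        assms(2))
qed

lemma eq_if_inner_eq:
  fixes u v :: "'a::real_inner"
  assumes "\<And>x. inner x u = inner x v"
  shows "u = v"
proof -
  have "inner (u - v) (u - v) = 0"
    using assms[of "u - v"] by (simp add: inner_diff_right)
  then show ?thesis by simp
qed

text \<open>Riesz representation of \<open>inner (T x) y\<close> as a functional of \<open>x\<close>
  gives the adjoint for the real inner product. Compatibility of \<open>T\<close> with
  multiplication by \<open>\<i>\<close> upgrades it to the complex one.\<close>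

lemma adjoint_exists:
  fixes T :: "'a::complex_hilbert \<Rightarrow> 'a"
  assumes T: "bounded_clinear T"
  obtains S where "bounded_clinear S" "\<And>x y. cinner (T x) y = cinner x (S y)"
proof -
  interpret T: bounded_linear T
    using T by (rule bounded_clinear_imp_linear)
  have "\<exists>z. \<forall>x. inner (T x) y = inner x z" for y
  proof -
    have "bounded_linear (\<lambda>x. inner (T x) y)"
      by (rule bounded_linear_inner_left_comp) (rule T.bounded_linear_axioms)
    from riesz_subspace[OF this subspace_UNIV closed_UNIV] show ?thesis
      by (metis UNIV_I inner_commute)
  qed
  then obtain S where S: "\<And>x y. inner (T x) y = inner x (S y)"
    by metis
  obtain K where K: "0 \<le> K" "\<And>x. norm (T x) \<le> norm x * K"
    using T.nonneg_bounded by blast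
  have "bounded_linear S"
  proof (rule bounded_linear_intro)
    show "S (x + y) = S x + S y" for x y
      by (rule eq_if_inner_eq) (simp add: S[symmetric] inner_add_right)
    show "S (r *\<^sub>R x) = r *\<^sub>R S x" for r x
      by (rule eq_if_inner_eq) (simp add: S[symmetric])
    show "norm (S y) \<le> norm y * K" for y
    proof (cases "S y = 0")
      case False
      have "norm (S y) * norm (S y) = inner (T (S y)) y"
        by (simp add: S dot_square_norm power2_eq_square)
      also have "\<dots> \<le> norm (T (S y)) * norm y"
        by (rule norm_cauchy_schwarz)
      also have "\<dots> \<le> (norm (S y) * K) * norm y"
        by (intro mult_right_mono K) auto
      finally show ?thesis
        using False by (simp add: mult.assoc mult.commute)
    qed (use K in simp)
  qed
  moreover have "S (\<i> *\<^sub>C x) = \<i> *\<^sub>C S x" for x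
    by (rule eq_if_inner_eq)
      (simp add: S[symmetric] inner_i_right bounded_clinear_scaleC[OF T, symmetric])
  ultimately have "bounded_clinear S"
    by (auto simp: bounded_clinear_def intro: complex_linear_if_i_linear bounded_linear.linear)
  moreover have "cinner (T x) y = cinner x (S y)" for x y
    by (simp add: cinner_eq_Complex S bounded_clinear_scaleC[OF T, symmetric])
  ultimately show thesis by (rule that)
qed

lemma cadjoint:
  fixes T :: "'a::complex_hilbert \<Rightarrow> 'a"
  assumes "bounded_clinear T"
  shows "bounded_clinear (cadjoint T) \<and> (\<forall>x y. cinner (T x) y = cinner x (cadjoint T y))"
proof -
  obtain S where S: "bounded_clinear S" "\<And>x y. cinner (T x) y = cinner x (S y)"
    using adjoint_exists[OF assms] by blast
  have unique: "S' = S" if "\<forall>x y. cinner (T x) y = cinner x (S' y)" for S'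
    by (rule ext, rule eq_if_inner_eq) (simp add: Re_cinner[symmetric] S(2)[symmetric] that)
  have "\<exists>!S. bounded_clinear S \<and> (\<forall>x y. cinner (T x) y = cinner x (S y))"
  proof (rule ex1I[of _ S])
    show "bounded_clinear S \<and> (\<forall>x y. cinner (T x) y = cinner x (S y))"
      using S by blast
  qed (blast intro: unique)
  from theI'[OF this] show ?thesis
    unfolding cadjoint_def .
qed

lemma inner_cadjoint:
  "bounded_clinear T \<Longrightarrow> inner (T x) y = inner x (cadjoint T y)"
  using cadjoint[of T] by (metis Re_cinner)

section \<open>The semi-inner product of a positive operator\<close>

locale positive_operator =
  fixes A :: "'a::complex_hilbert \<Rightarrow> 'a"
  assumes positive: "positive_op A"
begin

lemma clinear: "bounded_clinear A"
  and nonneg: "0 \<le> inner (A x) x"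
  and Im_zero: "Im (cinner (A x) x) = 0"
  using positive by (auto simp: positive_op_def Re_cinner complex_is_Real_iff)

sublocale bounded_linear A
  using clinear by (rule bounded_clinear_imp_linear)

text \<open>Polarization: since the quadratic form is real, the imaginary parts of the cross terms
  cancel. Inserting \<open>\<i> *\<^sub>C y\<close> turns them into real parts.\<close>

lemma symmetric: "inner (A x) y = inner x (A y)"
proof -
  have "Im (cinner (A x) z) + Im (cinner (A z) x) = 0" for z
    using Im_zero[of "x + z"] Im_zero[of x] Im_zero[of z]
    by (simp add: add cinner_add_left cinner_add_right)
  from this[of "\<i> *\<^sub>C y"] have "inner (A x) y = inner (A y) x"
    by (simp add: bounded_clinear_scaleC[OF clinear] cinner_scaleC_left cinner_scaleC_right
        Re_cinner)
  then show ?thesis by (simp add: inner_commute)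
qed

lemma A_norm_nonneg: "0 \<le> A_norm A x"
  and A_norm_sq: "(A_norm A x)\<^sup>2 = inner (A x) x"
  using nonneg[of x] by (auto simp: A_norm_def A_inner_def Re_cinner)

lemma A_norm_i: "A_norm A (\<i> *\<^sub>C x) = A_norm A x"
  by (simp add: A_norm_def A_inner_def bounded_clinear_scaleC[OF clinear] cinner_scaleC_left
        cinner_scaleC_right)

lemma A_norm_scaleR: "A_norm A (r *\<^sub>R x) = \<bar>r\<bar> * A_norm A x"
  by (simp add: A_norm_def A_inner_def Re_cinner scaleR real_sqrt_mult flip: mult.assoc)

text \<open>The usual discriminant argument, with a separate case for \<open>q = 0\<close> because
  the form may be degenerate.\<close>

lemma cauchy_schwarz: "\<bar>inner (A x) y\<bar> \<le> A_norm A x * A_norm A y"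
proof -
  define p q b where "p = inner (A x) x" and "q = inner (A y) y" and "b = inner (A x) y"
  have quad: "0 \<le> p + 2 * t * b + t\<^sup>2 * q" for t
    using nonneg[of "x + t *\<^sub>R y"] symmetric[of y x]
    by (simp add: p_def q_def b_def add scaleR inner_add inner_commute power2_eq_square
        algebra_simps)
  have "b\<^sup>2 \<le> p * q"
  proof (cases "q = 0")
    case True
    have "b = 0"
    proof (rule ccontr)
      assume "b \<noteq> 0"
      \<comment> \<open>With \<open>q = 0\<close> the form is affine in \<open>t\<close>; the chosen
        \<open>t\<close> makes it equal to \<open>-1\<close>.\<close>
      then show False
        using quad[of "- (p + 1) / (2 * b)"] True by (simp add: field_simps)
    qed
    then show ?thesis using True by simp
  next
    case False
    then have "q > 0" using nonneg[of y] by (simp add: q_def)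
    then show ?thesis
      using quad[of "- b / q"] by (simp add: field_simps power2_eq_square)
  qed
  also have "p * q = (A_norm A x * A_norm A y)\<^sup>2"
    by (simp add: p_def q_def power_mult_distrib A_norm_sq)
  finally show ?thesis
    unfolding b_def by (intro power2_le_imp_le[of "\<bar>_\<bar>"]) (auto simp: A_norm_nonneg)
qed

text \<open>Real and imaginary part are estimated separately, whence the factor 2. The bound only
  serves finiteness, so a sharp constant is not sought.\<close>

lemma cmod_A_inner_le: "cmod (A_inner A x y) \<le> 2 * (A_norm A x * A_norm A y)"
proof -
  have "cmod (A_inner A x y) \<le> \<bar>inner (A x) y\<bar> + \<bar>inner (A (\<i> *\<^sub>C x)) y\<bar>"
    using cmod_le[of "A_inner A x y"]
    by (simp add: A_inner_def cinner_eq_Complex bounded_clinear_scaleC[OF clinear])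
  then show ?thesis
    using cauchy_schwarz[of x y] cauchy_schwarz[of "\<i> *\<^sub>C x" y] by (simp add: A_norm_i)
qed

lemma A_norm_le:
  obtains K where "0 < K" "\<And>x. A_norm A x \<le> K * norm x"
proof -
  obtain K where K: "0 < K" "\<And>x. norm (A x) \<le> norm x * K"
    using pos_bounded by blast
  have "A_norm A x \<le> sqrt K * norm x" for x
  proof (rule power2_le_imp_le)
    have "(A_norm A x)\<^sup>2 \<le> norm (A x) * norm x"
      unfolding A_norm_sq by (rule norm_cauchy_schwarz)
    also have "\<dots> \<le> (norm x * K) * norm x"
      by (intro mult_right_mono K) auto
    finally show "(A_norm A x)\<^sup>2 \<le> (sqrt K * norm x)\<^sup>2"
      using K by (simp add: power_mult_distrib) (simp add: power2_eq_square mult_ac)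
  qed (use K in simp)
  with K show thesis by (intro that[of "sqrt K"]) auto
qed

lemma exists_unit:
  assumes "A \<noteq> (\<lambda>x. 0)"
  obtains x where "A_norm A x = 1"
proof -
  obtain x where x: "A x \<noteq> 0" using assms by auto
  \<comment> \<open>Pairing \<open>x\<close> with \<open>A x\<close> gives the positive number
    \<open>inner (A x) (A x)\<close>, which Cauchy-Schwarz bounds by a multiple of
    \<open>A_norm A x\<close>.\<close>
  have "A_norm A x \<noteq> 0"
    using cauchy_schwarz[of x "A x"] x inner_gt_zero_iff[of "A x"] by force
  then have "A_norm A ((1 / A_norm A x) *\<^sub>R x) = 1"
    using A_norm_nonneg[of x] by (simp add: A_norm_scaleR)
  then show thesis by (rule that)
qed

lemma subspace_closure_range: "subspace (closure (range A))"
  by (intro subspace_closure linear_subspace_image linear_axioms subspace_UNIV)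

text \<open>By symmetry the kernel is orthogonal to the range and to its closure, so
  \<open>d\<close> is orthogonal to itself. This yields the uniqueness of
  \<open>A_sharp\<close>.\<close>

lemma eq_0_if_kernel_range:
  assumes "d \<in> closure (range A)" "A d = 0"
  shows "d = 0"
proof -
  have "closure (range A) \<subseteq> {u. inner d u = 0}"
    using assms(2) symmetric[of d]
    by (intro closure_minimal closed_Collect_eq continuous_intros) auto
  then show ?thesis using assms(1) by auto
qed

text \<open>Take the orthogonal projection \<open>y\<close> of \<open>w\<close>: the difference is
  orthogonal to the range of \<open>A\<close>, hence in the kernel by symmetry.\<close>

lemma range_representative:
  obtains y where "y \<in> closure (range A)" "A y = A w"
proof -
  obtain y where y: "y \<in> closure (range A)"
      "\<And>m. m \<in> closure (range A) \<Longrightarrow> inner w m = inner y m"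
    using riesz_subspace[OF bounded_linear_inner_right subspace_closure_range closed_closure]
    by blast
  have "A y = A w"
  proof (rule eq_if_inner_eq)
    fix x
    have "A x \<in> closure (range A)"
      by (rule subsetD[OF closure_subset rangeI])
    from y(2)[OF this] show "inner x (A y) = inner x (A w)"
      by (metis inner_commute symmetric)
  qed
  with y(1) show thesis by (rule that)
qed

text \<open>An ordinary norm bound \<open>C\<close> for \<open>S\<close> is also a bound for the
  seminorm. If the first ratio \<open>r\<close> exceeded \<open>C\<close>, log-convexity would make
  the iterates grow at least like \<open>r ^ n\<close>, while their norms grow at most like
  \<open>C ^ n\<close>.\<close>

lemma A_norm_le_of_symmetric:
  assumes S: "bounded_linear S" "\<And>x y. inner (A (S x)) y = inner (A x) (S y)"
  obtains C where "0 \<le> C" "\<And>x. A_norm A x = 1 \<Longrightarrow> A_norm A (S x) \<le> C"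
proof -
  obtain C where C: "0 < C" "\<And>x. norm (S x) \<le> norm x * C"
    using bounded_linear.pos_bounded[OF S(1)] by blast
  obtain K where K: "0 < K" "\<And>x. A_norm A x \<le> K * norm x"
    using A_norm_le by blast
  have "A_norm A (S x) \<le> C" if x: "A_norm A x = 1" for x
  proof (rule ccontr)
    define r where "r = A_norm A (S x)"
    define a where "a n = A_norm A ((S ^^ n) x)" for n
    assume "\<not> A_norm A (S x) \<le> C"
    then have r: "C < r" by (simp add: r_def)
    \<comment> \<open>Symmetry moves one factor \<open>S\<close> to the other side before
      Cauchy-Schwarz is applied.\<close>
    have log_convex: "(a (Suc n))\<^sup>2 \<le> a n * a (Suc (Suc n))" for n
    proof -
      have "(a (Suc n))\<^sup>2 = inner (A ((S ^^ n) x)) ((S ^^ Suc (Suc n)) x)"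
        by (simp add: a_def A_norm_sq S(2))
      also have "\<dots> \<le> a n * a (Suc (Suc n))"
        using cauchy_schwarz[of "(S ^^ n) x" "(S ^^ Suc (Suc n)) x"] by (simp add: a_def)
      finally show ?thesis .
    qed
    \<comment> \<open>Successive ratios do not decrease. Positivity is carried along so that
      \<open>a n\<close> can be cancelled in the induction step.\<close>
    have growth: "0 < a n \<and> r * a n \<le> a (Suc n)" for n
    proof (induction n)
      case 0
      show ?case by (simp add: a_def r_def x)
    next
      case (Suc n)
      then have pos: "0 < a (Suc n)"
        using r C(1) by (smt (verit) mult_pos_pos)
      have "a n * (r * a (Suc n)) = (r * a n) * a (Suc n)" by simp
      also have "\<dots> \<le> a (Suc n) * a (Suc n)"
        using Suc pos by (intro mult_right_mono) auto
      also have "\<dots> \<le> a n * a (Suc (Suc n))"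
        using log_convex[of n] by (simp add: power2_eq_square)
      finally show ?case using Suc pos by auto
    qed
    have lower: "r ^ n \<le> a n" for n
    proof (induction n)
      case (Suc n)
      then have "r * r ^ n \<le> r * a n"
        using r C(1) by (intro mult_left_mono) auto
      with growth[of n] show ?case by auto
    qed (simp add: a_def x)
    have "norm ((S ^^ n) x) \<le> norm x * C ^ n" for n
    proof (induction n)
      case (Suc n)
      have "norm (S ((S ^^ n) x)) \<le> norm ((S ^^ n) x) * C" by (rule C)
      also have "\<dots> \<le> norm x * C ^ n * C"
        using Suc C(1) by (intro mult_right_mono) auto
      finally show ?case by (simp add: mult_ac)
    qed simp
    then have "a n \<le> K * (norm x * C ^ n)" for n
      unfolding a_def using K by (meson mult_left_mono less_imp_le order_trans)
    then have "r ^ n \<le> K * norm x * C ^ n" for n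
      using lower[of n] by (metis mult.assoc order_trans)
    then have "(r / C) ^ n \<le> K * norm x" for n
      using C(1) by (simp add: power_divide divide_simps)
    moreover obtain n where "K * norm x < (r / C) ^ n"
      using real_arch_pow[of "r / C"] r C(1) by auto
    ultimately show False by (meson not_le)
  qed
  with C(1) show thesis by (intro that[of C]) auto
qed

section \<open>Existence and uniqueness of \<open>A_sharp\<close>\<close>

context
  fixes T :: "'a \<Rightarrow> 'a"
  assumes T_B_A: "T \<in> B_A A"
begin

lemma T_clinear: "bounded_clinear T"
  and T_range: "\<exists>w. A w = cadjoint T (A x)"
  using T_B_A by (auto simp: B_A_def image_subset_iff) (metis rangeE)

text \<open>Each value \<open>X x\<close> is chosen separately as a solution in the closed range.
  Uniqueness of such solutions makes the choice linear, and uniform boundedness makes it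
  continuous.\<close>

lemma sharp_exists:
  obtains X where "bounded_clinear X" "A \<circ> X = cadjoint T \<circ> A" "range X \<subseteq> closure (range A)"
proof -
  have "\<exists>y. y \<in> closure (range A) \<and> A y = cadjoint T (A x)" for x
    using T_range range_representative by metis
  then obtain X where X: "\<And>x. X x \<in> closure (range A)" "\<And>x. A (X x) = cadjoint T (A x)"
    by metis
  have Tstar: "bounded_clinear (cadjoint T)"
    using cadjoint[OF T_clinear] by blast
  interpret Tstar: bounded_linear "cadjoint T"
    using Tstar by (rule bounded_clinear_imp_linear)
  \<comment> \<open>Linearity of \<open>X\<close> now only requires checking that the expected value
    solves the same equation in the same subspace.\<close>
  have X_eqI: "X x = y" if "y \<in> closure (range A)" "A y = cadjoint T (A x)" for x y
  proof -
    have "X x - y \<in> closure (range A)"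
      using X(1) that(1) subspace_closure_range by (intro subspace_diff)
    moreover have "A (X x - y) = 0"
      using X(2) that(2) by (simp add: diff)
    ultimately show ?thesis
      using eq_0_if_kernel_range by force
  qed
  have i_range: "\<i> *\<^sub>C y \<in> closure (range A)" if "y \<in> closure (range A)" for y
  proof -
    have "bounded_linear (\<lambda>y::'a. \<i> *\<^sub>C y)"
    proof (rule bounded_linear_intro[where K=1])
      show "\<i> *\<^sub>C (r *\<^sub>R x) = r *\<^sub>R (\<i> *\<^sub>C x)" for r and x :: 'a
        by (simp add: scaleC_of_real[symmetric] scaleC_scaleC mult.commute)
      show "norm (\<i> *\<^sub>C x) \<le> norm x * 1" for x :: 'a
        by (simp add: norm_eq_sqrt_inner inner_i_right scaleC_scaleC)
          (simp add: Re_cinner[symmetric] cinner_scaleC_left)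
    qed (rule scaleC_add_right)
    then have "(\<lambda>y. \<i> *\<^sub>C y) ` closure (range A) \<subseteq> closure ((\<lambda>y. \<i> *\<^sub>C y) ` range A)"
      by (rule closure_bounded_linear_image_subset)
    moreover have "(\<lambda>y. \<i> *\<^sub>C y) ` range A \<subseteq> range A"
      by (auto simp: bounded_clinear_scaleC[OF clinear, symmetric])
    ultimately show ?thesis
      using closure_mono that by blast
  qed
  have AT: "inner x (A (T z)) = inner (X x) (A z)" for x z
    using inner_cadjoint[OF T_clinear, of z "A x"]
    by (metis X(2) inner_commute symmetric)
  \<comment> \<open>On these vectors \<open>inner x\<close> is bounded by \<open>norm (X x)\<close>,
    since \<open>A (T z)\<close> pairs with \<open>x\<close> as \<open>A z\<close> pairs with
    \<open>X x\<close>. The uniform bound gives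
    \<open>norm (A (T z)) \<le> C * norm (A z)\<close>.\<close>
  define V where "V = {(1 / norm (A z)) *\<^sub>R A (T z) | z. A z \<noteq> 0}"
  have "\<exists>c. \<forall>v\<in>V. \<bar>inner x v\<bar> \<le> c" for x
  proof (intro exI[of _ "norm (X x)"] ballI)
    fix v assume "v \<in> V"
    then obtain z where z: "A z \<noteq> 0" "v = (1 / norm (A z)) *\<^sub>R A (T z)"
      by (auto simp: V_def)
    have "\<bar>inner (X x) (A z)\<bar> \<le> norm (X x) * norm (A z)"
      by (rule Cauchy_Schwarz_ineq2)
    then show "\<bar>inner x v\<bar> \<le> norm (X x)"
      using z by (simp add: AT divide_simps)
  qed
  then obtain C where C: "0 \<le> C" "\<And>v. v \<in> V \<Longrightarrow> norm v \<le> C"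
    using uniform_boundedness_inner by metis
  have bound_range: "\<bar>inner (X x) (A z)\<bar> \<le> norm x * C * norm (A z)" for x z
  proof (cases "A z = 0")
    case False
    then have "norm ((1 / norm (A z)) *\<^sub>R A (T z)) \<le> C"
      by (intro C) (auto simp: V_def)
    then have "norm (A (T z)) \<le> C * norm (A z)"
      using False by (simp add: divide_simps)
    then have "norm x * norm (A (T z)) \<le> norm x * (C * norm (A z))"
      by (intro mult_left_mono) auto
    then show ?thesis
      using Cauchy_Schwarz_ineq2[of x "A (T z)"] by (simp add: AT mult.assoc)
  qed simp
  have "bounded_linear X"
  proof (rule bounded_linear_intro)
    show "X (x + y) = X x + X y" for x y
      by (rule X_eqI) (auto simp: X add Tstar.add intro: subspace_add[OF subspace_closure_range])
    show "X (r *\<^sub>R x) = r *\<^sub>R X x" for r x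
      by (rule X_eqI)
        (auto simp: X scaleR Tstar.scaleR intro: subspace_scale[OF subspace_closure_range])
    show "norm (X x) \<le> norm x * C" for x
    proof (cases "X x = 0")
      case False
      \<comment> \<open>The estimate passes from the range to its closure, where \<open>X x\<close>
        itself is an admissible test vector.\<close>
      have "closure (range A) \<subseteq> {u. \<bar>inner (X x) u\<bar> \<le> norm x * C * norm u}"
        using bound_range by (intro closure_minimal closed_Collect_le continuous_intros) auto
      then have "\<bar>inner (X x) (X x)\<bar> \<le> norm x * C * norm (X x)"
        using X(1) by blast
      then show ?thesis
        using False by (simp add: dot_square_norm power2_eq_square)
    qed (use C in simp)
  qed
  moreover have "X (\<i> *\<^sub>C x) = \<i> *\<^sub>C X x" for x
    by (rule X_eqI)
      (auto simp: X bounded_clinear_scaleC[OF clinear] bounded_clinear_scaleC[OF Tstar]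
        intro: i_range)
  ultimately have "bounded_clinear X"
    by (auto simp: bounded_clinear_def intro: complex_linear_if_i_linear bounded_linear.linear)
  moreover have "A \<circ> X = cadjoint T \<circ> A"
    using X(2) by auto
  moreover have "range X \<subseteq> closure (range A)"
    using X(1) by auto
  ultimately show thesis by (rule that)
qed

lemma A_sharp:
  "bounded_clinear (A_sharp A T) \<and> A \<circ> A_sharp A T = cadjoint T \<circ> A
    \<and> range (A_sharp A T) \<subseteq> closure (range A)"
proof -
  obtain X where X: "bounded_clinear X" "A \<circ> X = cadjoint T \<circ> A" "range X \<subseteq> closure (range A)"
    using sharp_exists .
  have unique: "Y = X" if Y: "A \<circ> Y = cadjoint T \<circ> A" "range Y \<subseteq> closure (range A)" for Y
  proof
    fix x
    have "Y x - X x \<in> closure (range A)"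
      using X(3) Y(2) by (intro subspace_diff[OF subspace_closure_range]) auto
    moreover have "A (Y x - X x) = 0"
      using X(2) Y(1) by (simp add: diff fun_eq_iff)
    ultimately show "Y x = X x"
      using eq_0_if_kernel_range by force
  qed
  have "\<exists>!X. bounded_clinear X \<and> A \<circ> X = cadjoint T \<circ> A \<and> range X \<subseteq> closure (range A)"
  proof (rule ex1I[of _ X])
    show "bounded_clinear X \<and> A \<circ> X = cadjoint T \<circ> A \<and> range X \<subseteq> closure (range A)"
      using X by blast
  qed (blast intro: unique)
  from theI'[OF this] show ?thesis
    unfolding A_sharp_def .
qed

lemma A_inner_sharp: "cinner (A (A_sharp A T x)) y = cinner (A x) (T y)"
proof -
  have "A (A_sharp A T x) = cadjoint T (A x)"
    using A_sharp by (simp add: fun_eq_iff)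
  then show ?thesis
    using cadjoint[OF T_clinear] by (metis cinner_commute)
qed

lemma A_inner_sharp_T: "A_inner A (A_sharp A T (T x)) x = of_real ((A_norm A (T x))\<^sup>2)"
  using Im_zero[of "T x"]
  by (simp add: A_inner_def A_inner_sharp complex_eq_iff A_norm_sq Re_cinner del: of_real_power)

section \<open>Finiteness of the suprema and the pointwise inequality\<close>

text \<open>\<open>T\<close> need not be symmetric for the semi-inner product, but \<open>S\<close>
  is, and \<open>(A_norm A (T x))\<^sup>2\<close> is the form of \<open>S\<close> at
  \<open>x\<close>. A bound \<open>C\<close> for \<open>S\<close> therefore gives
  \<open>sqrt C\<close> for \<open>T\<close>.\<close>

lemma A_norm_T_bounded:
  obtains C where "0 \<le> C" "\<And>x. A_norm A x = 1 \<Longrightarrow> A_norm A (T x) \<le> C"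
proof -
  define S where "S x = A_sharp A T (T x)" for x
  have "bounded_linear S"
    unfolding S_def using A_sharp T_clinear
    by (auto intro: bounded_linear_compose bounded_clinear_imp_linear)
  moreover have S: "inner (A (S x)) y = inner (A (T x)) (T y)" for x y
    using A_inner_sharp[of "T x" y] by (simp add: S_def Re_cinner[symmetric])
  then have "inner (A (S x)) y = inner (A x) (S y)" for x y
    by (metis inner_commute symmetric)
  ultimately obtain C where C: "0 \<le> C" "\<And>x. A_norm A x = 1 \<Longrightarrow> A_norm A (S x) \<le> C"
    using A_norm_le_of_symmetric by metis
  have "A_norm A (T x) \<le> sqrt C" if "A_norm A x = 1" for x
  proof (rule real_le_rsqrt)
    have "(A_norm A (T x))\<^sup>2 = inner (A (S x)) x"
      by (simp add: A_norm_sq S)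
    also have "\<dots> \<le> C"
      using cauchy_schwarz[of "S x" x] C(2)[OF that] that by simp
    finally show "(A_norm A (T x))\<^sup>2 \<le> C" .
  qed
  with C(1) show thesis by (intro that[of "sqrt C"]) auto
qed

lemma A_norm_T_le_op_norm:
  assumes "A_norm A x = 1"
  shows "A_norm A (T x) \<le> A_op_norm A T"
proof -
  obtain C where "\<And>x. A_norm A x = 1 \<Longrightarrow> A_norm A (T x) \<le> C"
    using A_norm_T_bounded by blast
  then have "bdd_above ((\<lambda>x. A_norm A (T x)) ` {x. A_norm A x = 1})"
    by (intro bdd_aboveI2) auto
  then show ?thesis
    unfolding A_op_norm_def using assms by (intro cSUP_upper) auto
qed

text \<open>A real supremum dominates its values once these are bounded above; the crude bounds
  \<open>2 * C\<close> and \<open>C\<^sup>2 + 2 * C\<close> ensure this.\<close>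

lemma cmod_le_num_radius:
  assumes "A_norm A x = 1"
  shows "cmod (A_inner A (T x) x) \<le> A_num_radius A T" (is ?T)
    and "cmod (A_inner A (A_sharp A T (T x) - T x) x)
      \<le> A_num_radius A (\<lambda>x. A_sharp A T (T x) - T x)" (is ?S)
proof -
  obtain C where C: "0 \<le> C" "\<And>x. A_norm A x = 1 \<Longrightarrow> A_norm A (T x) \<le> C"
    using A_norm_T_bounded by blast
  have T_le: "cmod (A_inner A (T x) x) \<le> 2 * C" if "A_norm A x = 1" for x
    using cmod_A_inner_le[of "T x" x] C(2)[OF that] that by simp
  then have "bdd_above ((\<lambda>x. cmod (A_inner A (T x) x)) ` {x. A_norm A x = 1})"
    by (intro bdd_aboveI2) auto
  then show ?T
    unfolding A_num_radius_def using assms by (intro cSUP_upper) auto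
  have "cmod (A_inner A (A_sharp A T (T x) - T x) x) \<le> C\<^sup>2 + 2 * C" if "A_norm A x = 1" for x
  proof -
    have "A_inner A (A_sharp A T (T x) - T x) x
        = A_inner A (A_sharp A T (T x)) x - A_inner A (T x) x"
      unfolding A_inner_def
      by (metis add_diff_cancel_right' cinner_add_left diff diff_add_cancel)
    then have "cmod (A_inner A (A_sharp A T (T x) - T x) x)
        \<le> (A_norm A (T x))\<^sup>2 + cmod (A_inner A (T x) x)"
      using norm_triangle_ineq4[of "A_inner A (A_sharp A T (T x)) x" "A_inner A (T x) x"]
      by (simp add: A_inner_sharp_T norm_power)
    also have "\<dots> \<le> C\<^sup>2 + 2 * C"
      using T_le[OF that] C(2)[OF that] by (intro add_mono power_mono) (auto simp: A_norm_nonneg)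
    finally show ?thesis .
  qed
  then have "bdd_above ((\<lambda>x. cmod (A_inner A (A_sharp A T (T x) - T x) x)) ` {x. A_norm A x = 1})"
    by (intro bdd_aboveI2) auto
  then show ?S
    unfolding A_num_radius_def using assms by (intro cSUP_upper) auto
qed

lemma DW_bound:
  assumes x: "A_norm A x = 1"
  shows "(cmod (A_inner A (T x) x))\<^sup>2 + (A_norm A (T x)) ^ 4
    \<le> (A_num_radius A (\<lambda>x. A_sharp A T (T x) - T x))\<^sup>2
      + 2 * (A_op_norm A T)\<^sup>2 * A_num_radius A T"
proof -
  define a n where "a = A_inner A (T x) x" and "n = (A_norm A (T x))\<^sup>2"
  have diff_eq: "A_inner A (A_sharp A T (T x) - T x) x = of_real n - a"
    unfolding a_def n_def A_inner_sharp_T[symmetric] A_inner_def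
    by (metis add_diff_cancel_right' cinner_add_left diff diff_add_cancel)
  have "(cmod a)\<^sup>2 + n\<^sup>2 = (cmod (of_real n - a))\<^sup>2 + 2 * n * Re a"
    unfolding cmod_power2 by (simp add: power2_eq_square algebra_simps)
  also have "\<dots> \<le> (A_num_radius A (\<lambda>x. A_sharp A T (T x) - T x))\<^sup>2
      + 2 * (A_op_norm A T)\<^sup>2 * A_num_radius A T"
  proof (intro add_mono power_mono)
    show "cmod (of_real n - a) \<le> A_num_radius A (\<lambda>x. A_sharp A T (T x) - T x)"
      using cmod_le_num_radius(2)[OF x] by (simp add: diff_eq)
    have "Re a \<le> A_num_radius A T"
      using cmod_le_num_radius(1)[OF x] complex_Re_le_cmod[of a] by (simp add: a_def)
    moreover have "0 \<le> A_num_radius A T"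
      using cmod_le_num_radius(1)[OF x] norm_ge_zero order_trans by blast
    moreover have "n \<le> (A_op_norm A T)\<^sup>2"
      unfolding n_def using A_norm_T_le_op_norm[OF x] by (intro power_mono A_norm_nonneg)
    \<comment> \<open>\<open>Re a\<close> may be negative, so it is first replaced by the
      nonnegative numerical radius and only then \<open>n\<close> by its upper bound.\<close>
    ultimately have "n * Re a \<le> (A_op_norm A T)\<^sup>2 * A_num_radius A T"
      by (metis mult_left_mono mult_right_mono n_def order_trans zero_le_power2)
    then show "2 * n * Re a \<le> 2 * (A_op_norm A T)\<^sup>2 * A_num_radius A T"
      by simp
  qed simp
  finally show ?thesis
    by (simp add: a_def n_def flip: power_mult)
qed

end

end

theorem theorem2p11:
  fixes A T :: "'a::complex_hilbert \<Rightarrow> 'a"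
  assumes "positive_op A"
    and "A \<noteq> (\<lambda>x. 0)"
    and "T \<in> B_A A"
  shows "A_DW_radius A T \<le>
    sqrt ((A_num_radius A (\<lambda>x. A_sharp A T (T x) - T x))\<^sup>2
      + 2 * (A_op_norm A T)\<^sup>2 * A_num_radius A T)"
proof -
  interpret positive_operator A
    using assms(1) by unfold_locales
  \<comment> \<open>A unit vector is needed because \<open>cSUP_least\<close> requires a nonempty
    index set.\<close>
  obtain x where "A_norm A x = 1"
    using exists_unit[OF assms(2)] .
  then show ?thesis
    unfolding A_DW_radius_def
    by (intro cSUP_least real_sqrt_le_mono DW_bound[OF assms(3)]) auto
qed

end
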